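(* A graph $G$ is isomorphic to a letter graph $G(\mathcal{P},w)$ for the alphabet $\{a,b,c\}$, the decoder $\mathcal{P}=\{(a,b),(b,c),(c,a)\}$ and some word $w$ over $\{a,b,c\}$ if and only if $G$ is nice, i.e. iff $V(G)$ can be partitioned into three independent sets $A,B,C$ such that (a) $G[A\cup B]$, $G[B\cup C]$ and $G[C\cup A]$ are $2K_2$-free bipartite graphs, and (b) there are no three vertices $a\in A$, $b\in B$, $c\in C$ inducing either a triangle or an independent set of size 3.
   Context: For a finite alphabet $\Sigma$, a decoder $\mathcal{P}\subseteq\Sigma^2$ (set of ordered pairs) and a word $w=w_1\cdots w_n$ over $\Sigma$, the letter graph $G(\mathcal{P},w)$ has vertex set $\{1,\dots,n\}$, with $i<j$ adjacent iff $(w_i,w_j)\in\mathcal{P}$. Independent sets in the partition are allowed to be empty. *)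

theory Defs
  imports "Graph_Theory.Graph_Theory"
begin

text \<open>
  Undirected graphs follow the convention of the Graph Theory library: a finite simple graph is a
  finite loop-free symmetric digraph without parallel arcs (locale \<^locale>\<open>pair_graph\<close>), every edge
  being represented by its two opposite arcs.
\<close>

definition letter_graph :: "('s \<times> 's) set \<Rightarrow> 's list \<Rightarrow> nat pair_pre_digraph" where
  "letter_graph P w =
    \<lparr> pverts = {1..length w},
      parcs = {(i, j). i \<in> {1..length w} \<and> j \<in> {1..length w} \<and>
        (i < j \<and> (w ! (i - 1), w ! (j - 1)) \<in> P \<or>
         j < i \<and> (w ! (j - 1), w ! (i - 1)) \<in> P)} \<rparr>"

lemma pair_graph_letter_graph: "pair_graph (letter_graph P w)"
proof -
  have "finite (parcs (letter_graph P w))"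
    by (rule finite_subset[of _ "{1..length w} \<times> {1..length w}"]) (auto simp: letter_graph_def)
  then show ?thesis
    by unfold_locales (auto simp: letter_graph_def symmetric_def intro!: symI)
qed

datatype abc = La | Lb | Lc

definition cyclic_decoder :: "(abc \<times> abc) set" where
  "cyclic_decoder = {(La, Lb), (Lb, Lc), (Lc, La)}"

definition independent_set :: "('a, 'b) pre_digraph \<Rightarrow> 'a set \<Rightarrow> bool" where
  "independent_set G S \<longleftrightarrow> S \<subseteq> verts G \<and> (\<forall>u\<in>S. \<forall>v\<in>S. \<not> u \<rightarrow>\<^bsub>G\<^esub> v)"

definition bipartite :: "('a, 'b) pre_digraph \<Rightarrow> bool" where
  "bipartite G \<longleftrightarrow>
    (\<exists>U V. verts G = U \<union> V \<and> U \<inter> V = {} \<and> independent_set G U \<and> independent_set G V)"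

definition two_K2 :: "nat pair_pre_digraph" where
  "two_K2 = \<lparr> pverts = {0, 1, 2, 3}, parcs = {(0, 1), (1, 0), (2, 3), (3, 2)} \<rparr>"

definition two_K2_free :: "('a, 'b) pre_digraph \<Rightarrow> bool" where
  "two_K2_free G \<longleftrightarrow> \<not> (\<exists>H. induced_subgraph H G \<and> digraph_iso H (with_proj two_K2))"

text \<open>The parts \<open>A\<close>, \<open>B\<close>, \<open>C\<close> may be empty.\<close>

definition nice :: "('a, 'b) pre_digraph \<Rightarrow> bool" where
  "nice G \<longleftrightarrow> (\<exists>A B C.
    verts G = A \<union> B \<union> C \<and> A \<inter> B = {} \<and> B \<inter> C = {} \<and> C \<inter> A = {} \<and>
    independent_set G A \<and> independent_set G B \<and> independent_set G C \<and>
    (\<forall>S\<in>{A \<union> B, B \<union> C, C \<union> A}. bipartite (G \<restriction> S) \<and> two_K2_free (G \<restriction> S)) \<and>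
    \<not> (\<exists>a\<in>A. \<exists>b\<in>B. \<exists>c\<in>C.
        K\<^bsub>3\<^esub> (G \<restriction> {a, b, c}) \<or> independent_set G {a, b, c} \<and> card {a, b, c} = 3))"

end

theory Submission
  imports Defs
begin

text \<open>
  Label the vertices by their parts and orient each pair \<open>u\<close>, \<open>v\<close> with different labels from \<open>u\<close> to
  \<open>v\<close> iff adjacency of \<open>u\<close> and \<open>v\<close> agrees with membership of the pair of labels in the decoder. In a
  letter graph this is the order of the positions. For an arbitrary labelling, triangles and
  independent triples across the parts are the directed 3-cycles, and induced \<open>2K\<^sub>2\<close> between
  two parts are the directed 4-cycles. A shortest directed cycle of a multipartite tournament has
  length 3 or is a 4-cycle alternating between two parts, so niceness makes the orientation acyclic,
  and a topological ordering spells out the word.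
\<close>

section \<open>Isomorphism and forbidden subgraphs in terms of arcs\<close>

text \<open>A \<open>digraph_isomorphism\<close> carries separate maps for vertices, arcs, heads and
  tails. In a pair digraph an arc is its pair of ends, so the vertex map determines the
  rest.\<close>

lemma digraph_iso_with_proj_iff:
  assumes "pair_wf_digraph G" and "pair_wf_digraph H"
  shows "digraph_iso (with_proj G) (with_proj H) \<longleftrightarrow>
    (\<exists>f. bij_betw f (pverts G) (pverts H) \<and>
      (\<forall>u\<in>pverts G. \<forall>v\<in>pverts G. (u, v) \<in> parcs G \<longleftrightarrow> (f u, f v) \<in> parcs H))"
    (is "?L \<longleftrightarrow> ?R")
proof
  interpret G: pair_wf_digraph G by fact
  assume ?L
  then obtain h where h: "pre_digraph.digraph_isomorphism (with_proj G) h"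
    and H: "with_proj H = app_iso h (with_proj G)"
    unfolding digraph_iso_def by blast
  let ?f = "iso_verts h"
  have inj: "inj_on ?f (pverts G)"
    using h by (simp add: pre_digraph.digraph_isomorphism_def)
  have pvH: "pverts H = ?f ` pverts G"
    using arg_cong[OF H, of verts] by simp
  have paH: "parcs H = (\<lambda>(u, v). (?f u, ?f v)) ` parcs G"
    using arg_cong[OF H, of arcs_ends] G.arcs_ends_app_iso_eq[OF h] by simp
  have "(u, v) \<in> parcs G \<longleftrightarrow> (?f u, ?f v) \<in> parcs H" if "u \<in> pverts G" "v \<in> pverts G" for u v
    using that inj unfolding paH by (auto dest: inj_onD G.wellformed')
  with inj pvH show ?R by (auto simp: bij_betw_def)
next
  interpret G: pair_wf_digraph G by fact
  interpret H: pair_wf_digraph H by fact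
  assume ?R
  then obtain f where inj: "inj_on f (pverts G)" and im: "f ` pverts G = pverts H"
    and arc: "\<And>u v. u \<in> pverts G \<Longrightarrow> v \<in> pverts G \<Longrightarrow> (u, v) \<in> parcs G \<longleftrightarrow> (f u, f v) \<in> parcs H"
    unfolding bij_betw_def by blast
  \<comment> \<open>The arc map is forced by \<open>f\<close>. The components \<open>snd\<close> and
    \<open>fst\<close> become head and tail of the image, so the image is again of the form
    \<open>with_proj\<close>.\<close>
  define h where "h = \<lparr>iso_verts = f, iso_arcs = map_prod f f, iso_head = snd, iso_tail = fst\<rparr>"
  have "inj_on (map_prod f f) (parcs G)"
  proof (rule inj_onI)
    fix e e' assume "e \<in> parcs G" "e' \<in> parcs G" "map_prod f f e = map_prod f f e'"
    then show "e = e'"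
      using inj_onD[OF inj, of "fst e" "fst e'"] inj_onD[OF inj, of "snd e" "snd e'"]
        G.wellformed by (simp add: prod_eq_iff)
  qed
  then have iso: "pre_digraph.digraph_isomorphism (with_proj G) h"
    using inj G.wf_digraph_axioms by (auto simp: pre_digraph.digraph_isomorphism_def h_def)
  have "parcs H \<subseteq> map_prod f f ` parcs G"
  proof
    fix e assume e: "e \<in> parcs H"
    obtain x y where xy: "e = (x, y)" by (cases e)
    with e obtain u v where "x = f u" "y = f v" "u \<in> pverts G" "v \<in> pverts G"
      using im H.wellformed' by blast
    with e xy arc show "e \<in> map_prod f f ` parcs G" by force
  qed
  moreover have "map_prod f f ` parcs G \<subseteq> parcs H"
    using arc by (auto dest: G.wellformed')
  ultimately have "with_proj H = app_iso h (with_proj G)"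
    using im by (auto simp: app_iso_def h_def with_proj_def)
  with iso show ?L unfolding digraph_iso_def by blast
qed

lemma induce_subgraph_with_proj:
  "with_proj G \<restriction> S = with_proj \<lparr>pverts = S, parcs = {(u, v) \<in> parcs G. u \<in> S \<and> v \<in> S}\<rparr>"
  by (auto simp: induce_subgraph_def with_proj_def)

text \<open>The vertices \<open>x\<close>, \<open>y\<close>, \<open>x'\<close>, \<open>y'\<close>
  play the roles of 0, 1, 2, 3 in \<open>two_K2\<close>. The arcs and non-arcs listed determine all
  others by symmetry and the absence of loops.\<close>

lemma (in pair_graph) two_K2_free_induce_iff:
  assumes "S \<subseteq> pverts G"
  shows "two_K2_free (with_proj G \<restriction> S) \<longleftrightarrow>
    \<not> (\<exists>x\<in>S. \<exists>y\<in>S. \<exists>x'\<in>S. \<exists>y'\<in>S. (x, y) \<in> parcs G \<and> (x', y') \<in> parcs G \<and>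
        distinct [x, y, x', y'] \<and>
        (x, x') \<notin> parcs G \<and> (x, y') \<notin> parcs G \<and> (y, x') \<notin> parcs G \<and> (y, y') \<notin> parcs G)"
    (is "_ \<longleftrightarrow> \<not> ?R")
proof -
  let ?K = "\<lambda>T. \<lparr>pverts = T, parcs = {(u, v) \<in> parcs G. u \<in> T \<and> v \<in> T}\<rparr>"
  have wfK: "pair_wf_digraph (?K T)" for T by unfold_locales auto
  have wf2: "pair_wf_digraph two_K2" by unfold_locales (auto simp: two_K2_def)
  \<comment> \<open>An induced subgraph is determined by its vertex set: compatibility fixes head
    and tail, and inducedness fixes the arcs. So \<open>H\<close> can be traded for a set
    \<open>T\<close>.\<close>
  have "(\<exists>H. induced_subgraph H (with_proj G \<restriction> S) \<and> digraph_iso H (with_proj two_K2)) \<longleftrightarrow>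
    (\<exists>T\<subseteq>S. digraph_iso (with_proj (?K T)) (with_proj two_K2))" (is "?A \<longleftrightarrow> ?B")
  proof
    assume ?A
    then obtain H where ind: "induced_subgraph H (with_proj (?K S))"
      and iso: "digraph_iso H (with_proj two_K2)"
      by (auto simp: induce_subgraph_with_proj)
    then have sub: "verts H \<subseteq> S" and "tail H = fst" "head H = snd"
      and "arcs H = {(u, v) \<in> parcs G. u \<in> verts H \<and> v \<in> verts H}"
      by (auto simp: induced_subgraph_def subgraph_def compatible_def)
    then have "H = with_proj (?K (verts H))"
      by (auto simp: with_proj_def)
    with iso have "digraph_iso (with_proj (?K (verts H))) (with_proj two_K2)" by simp
    with sub show ?B by blast
  next
    assume ?B
    then obtain T where T: "T \<subseteq> S" "digraph_iso (with_proj (?K T)) (with_proj two_K2)" by blast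
    have "induced_subgraph (with_proj (?K T)) (with_proj (?K S))"
      using T(1) wfK
      by (auto simp: induced_subgraph_def subgraph_def wf_digraph_wp_iff)
    with T show ?A by (auto simp: induce_subgraph_with_proj)
  qed
  also have "\<dots> \<longleftrightarrow> ?R"
  proof
    assume ?B
    then obtain T f where T: "T \<subseteq> S" and bij: "bij_betw f T {0, 1, 2, 3 :: nat}"
      and arc: "\<forall>u\<in>T. \<forall>v\<in>T. (u, v) \<in> parcs G \<longleftrightarrow> (f u, f v) \<in> {(0, 1), (1, 0), (2, 3), (3, 2)}"
      unfolding digraph_iso_with_proj_iff[OF wfK wf2] by (auto simp: two_K2_def)
    have im: "f ` T = {0, 1, 2, 3}" using bij by (simp add: bij_betw_def)
    obtain x where x: "x \<in> T" "f x = 0" using im by (metis imageE insertI1)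
    obtain y where y: "y \<in> T" "f y = 1" using im by (metis imageE insertI1 insertI2)
    obtain x' where x': "x' \<in> T" "f x' = 2" using im by (metis imageE insertI1 insertI2)
    obtain y' where y': "y' \<in> T" "f y' = 3" using im by (metis imageE insertI1 insertI2)
    have "distinct [x, y, x', y']" using x y x' y' by auto
    then show ?R using x y x' y' arc T
      by (intro bexI[of _ x] bexI[of _ y] bexI[of _ x'] bexI[of _ y']) auto
  next
    assume ?R
    then obtain x y x' y' where S: "{x, y, x', y'} \<subseteq> S" and d: "distinct [x, y, x', y']"
      and arc: "(x, y) \<in> parcs G" "(x', y') \<in> parcs G" "(x, x') \<notin> parcs G" "(x, y') \<notin> parcs G"
        "(y, x') \<notin> parcs G" "(y, y') \<notin> parcs G"
      by blast
    \<comment> \<open>The final value 3 is meant for \<open>y'\<close>; what \<open>f\<close> does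
      outside the four vertices is irrelevant.\<close>
    define f :: "'a \<Rightarrow> nat" where
      "f v = (if v = x then 0 else if v = y then 1 else if v = x' then 2 else 3)" for v
    have f: "f x = 0" "f y = 1" "f x' = 2" "f y' = 3" using d by (auto simp: f_def)
    have "bij_betw f {x, y, x', y'} {0, 1, 2, 3}"
      using d by (auto simp: bij_betw_def f)
    moreover have "\<forall>u\<in>{x, y, x', y'}. \<forall>v\<in>{x, y, x', y'}.
      (u, v) \<in> parcs G \<longleftrightarrow> (f u, f v) \<in> {(0, 1), (1, 0), (2, 3), (3, 2)}"
      using arc arcs_symmetric no_loops' by (simp add: f) blast
    ultimately have "digraph_iso (with_proj (?K {x, y, x', y'})) (with_proj two_K2)"
      unfolding digraph_iso_with_proj_iff[OF wfK wf2]
      by (intro exI[of _ f]) (simp add: two_K2_def)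
    with S show ?B by blast
  qed
  finally show ?thesis unfolding two_K2_free_def by simp
qed

text \<open>By symmetry, one arc for each of the three pairs yields all six arcs; they are listed
  cyclically to match the directed 3-cycles considered later.\<close>

lemma (in pair_graph) complete_3_induce_iff:
  assumes "{a, b, c} \<subseteq> pverts G" and "distinct [a, b, c]"
  shows "K\<^bsub>3\<^esub> (with_proj G \<restriction> {a, b, c}) \<longleftrightarrow>
    (a, b) \<in> parcs G \<and> (b, c) \<in> parcs G \<and> (c, a) \<in> parcs G"
proof -
  have "card {a, b, c} = 3" using assms by simp
  then show ?thesis
    unfolding induce_subgraph_with_proj complete_digraph_pair_def
    using assms(2) arcs_symmetric no_loops' by (simp add: set_eq_iff) blast
qed

section \<open>Niceness as a condition on vertex labellings\<close>

text \<open>The second clause is 2K_2-freeness between two label classes: the non-edges inside the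
  classes come from the first clause. The third ranges over all orders of the three labels, so a
  cyclic triple may be entered at any vertex and in either direction.\<close>

definition labelling_nice :: "'a pair_pre_digraph \<Rightarrow> ('a \<Rightarrow> abc) \<Rightarrow> bool" where
  "labelling_nice G lab \<longleftrightarrow>
    (\<forall>u v. (u, v) \<in> parcs G \<longrightarrow> lab u \<noteq> lab v) \<and>
    (\<forall>x\<in>pverts G. \<forall>y\<in>pverts G. \<forall>x'\<in>pverts G. \<forall>y'\<in>pverts G.
      lab x = lab x' \<and> lab y = lab y' \<and> lab x \<noteq> lab y \<and>
      (x, y) \<in> parcs G \<and> (x', y') \<in> parcs G \<longrightarrow> (x, y') \<in> parcs G \<or> (x', y) \<in> parcs G) \<and>
    (\<forall>x\<in>pverts G. \<forall>y\<in>pverts G. \<forall>z\<in>pverts G. distinct [lab x, lab y, lab z] \<longrightarrow>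
      \<not> ((x, y) \<in> parcs G \<and> (y, z) \<in> parcs G \<and> (z, x) \<in> parcs G) \<and>
      \<not> ((x, y) \<notin> parcs G \<and> (y, z) \<notin> parcs G \<and> (z, x) \<notin> parcs G))"

lemma (in pair_graph) nice_iff_labelling: "nice (with_proj G) \<longleftrightarrow> (\<exists>lab. labelling_nice G lab)"
proof
  let ?E = "parcs G"
  assume "nice (with_proj G)"
  then obtain A B C where V: "pverts G = A \<union> B \<union> C"
    and disj: "A \<inter> B = {}" "B \<inter> C = {}" "C \<inter> A = {}"
    and indep: "\<forall>u\<in>A. \<forall>v\<in>A. (u, v) \<notin> ?E" "\<forall>u\<in>B. \<forall>v\<in>B. (u, v) \<notin> ?E"
      "\<forall>u\<in>C. \<forall>v\<in>C. (u, v) \<notin> ?E"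
    and free: "\<And>S. S \<in> {A \<union> B, B \<union> C, C \<union> A} \<Longrightarrow> two_K2_free (with_proj G \<restriction> S)"
    and triple: "\<And>a b c. a \<in> A \<Longrightarrow> b \<in> B \<Longrightarrow> c \<in> C \<Longrightarrow>
      \<not> K\<^bsub>3\<^esub> (with_proj G \<restriction> {a, b, c}) \<and>
      \<not> (independent_set (with_proj G) {a, b, c} \<and> card {a, b, c} = 3)"
  proof -
    from \<open>nice (with_proj G)\<close> obtain A B C where ABC: "pverts G = A \<union> B \<union> C"
      "A \<inter> B = {}" "B \<inter> C = {}" "C \<inter> A = {}"
      "independent_set (with_proj G) A" "independent_set (with_proj G) B" "independent_set (with_proj G) C"
      "\<forall>S\<in>{A \<union> B, B \<union> C, C \<union> A}. bipartite (with_proj G \<restriction> S) \<and> two_K2_free (with_proj G \<restriction> S)"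
      "\<not> (\<exists>a\<in>A. \<exists>b\<in>B. \<exists>c\<in>C. K\<^bsub>3\<^esub> (with_proj G \<restriction> {a, b, c}) \<or>
        independent_set (with_proj G) {a, b, c} \<and> card {a, b, c} = 3)"
      unfolding nice_def with_proj_simps by (elim exE conjE) (rule that)
    show thesis
    proof (rule that[of A B C])
      show "\<forall>u\<in>A. \<forall>v\<in>A. (u, v) \<notin> ?E" "\<forall>u\<in>B. \<forall>v\<in>B. (u, v) \<notin> ?E"
        "\<forall>u\<in>C. \<forall>v\<in>C. (u, v) \<notin> ?E"
        using ABC(5-7) by (auto simp: independent_set_def)
    qed (use ABC in blast)+
  qed
  \<comment> \<open>The default \<open>Lc\<close> also catches non-vertices; on vertices it means
    membership in \<open>C\<close>, since the three sets cover the graph.\<close>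
  define lab where "lab u = (if u \<in> A then La else if u \<in> B then Lb else Lc)" for u
  have lab_iff: "lab u = La \<longleftrightarrow> u \<in> A" "lab u = Lb \<longleftrightarrow> u \<in> B" "lab u = Lc \<longleftrightarrow> u \<in> C"
    if "u \<in> pverts G" for u
    using that V disj by (auto simp: lab_def)
  have sym: "(u, v) \<in> ?E \<longleftrightarrow> (v, u) \<in> ?E" for u v using arcs_symmetric by blast
  have edge: "lab u \<noteq> lab v" if "(u, v) \<in> ?E" for u v
    using that in_arcsD1[OF that] in_arcsD2[OF that] lab_iff[of u] lab_iff[of v] indep
    by (cases "lab u"; cases "lab v") auto
  have "(x, y') \<in> ?E \<or> (x', y) \<in> ?E"
    if vs: "x \<in> pverts G" "y \<in> pverts G" "x' \<in> pverts G" "y' \<in> pverts G"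
      and lab: "lab x = lab x'" "lab y = lab y'" "lab x \<noteq> lab y"
      and E: "(x, y) \<in> ?E" "(x', y') \<in> ?E" for x y x' y'
  proof (rule ccontr)
    assume nE: "\<not> ?thesis"
    \<comment> \<open>The four vertices carry only two labels, so they lie in the union of two
      parts.\<close>
    obtain S where S: "S \<in> {A \<union> B, B \<union> C, C \<union> A}" "x \<in> S" "y \<in> S" "x' \<in> S" "y' \<in> S"
      using lab lab_iff[OF vs(1)] lab_iff[OF vs(2)] lab_iff[OF vs(3)] lab_iff[OF vs(4)]
      by (cases "lab x"; cases "lab y") auto
    have "distinct [x, y, x', y']" using lab E nE by auto
    moreover have "(x, x') \<notin> ?E" "(y, y') \<notin> ?E" using edge lab by auto
    moreover have "(x, y') \<notin> ?E" "(y, x') \<notin> ?E" using nE sym[of y x'] by auto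
    moreover have "S \<subseteq> pverts G" using S(1) V by auto
    ultimately show False
      using free[OF S(1)] two_K2_free_induce_iff[of S] S(2-5) E by blast
  qed
  moreover have abc: "\<not> ((a, b) \<in> ?E \<and> (b, c) \<in> ?E \<and> (c, a) \<in> ?E)"
    "\<not> ((a, b) \<notin> ?E \<and> (b, c) \<notin> ?E \<and> (c, a) \<notin> ?E)"
    if abc: "a \<in> A" "b \<in> B" "c \<in> C" for a b c
  proof -
    have V': "{a, b, c} \<subseteq> pverts G" and d: "distinct [a, b, c]" using abc disj V by auto
    show "\<not> ((a, b) \<in> ?E \<and> (b, c) \<in> ?E \<and> (c, a) \<in> ?E)"
      using triple[OF abc] complete_3_induce_iff[OF V' d] by blast
    show "\<not> ((a, b) \<notin> ?E \<and> (b, c) \<notin> ?E \<and> (c, a) \<notin> ?E)"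
      using triple[OF abc] V' d sym[of a b] sym[of b c] sym[of c a] no_loops'
      by (auto simp: independent_set_def)
  qed
  \<comment> \<open>The labels may occur in any of six orders, so \<open>abc\<close> is supplied in
    all six arrangements.\<close>
  have "\<not> ((x, y) \<in> ?E \<and> (y, z) \<in> ?E \<and> (z, x) \<in> ?E) \<and>
      \<not> ((x, y) \<notin> ?E \<and> (y, z) \<notin> ?E \<and> (z, x) \<notin> ?E)"
    if vs: "x \<in> pverts G" "y \<in> pverts G" "z \<in> pverts G"
      and d: "distinct [lab x, lab y, lab z]" for x y z
    using d lab_iff[OF vs(1)] lab_iff[OF vs(2)] lab_iff[OF vs(3)] sym[of x y] sym[of y z] sym[of z x]
      abc[of x y z] abc[of y z x] abc[of z x y] abc[of x z y] abc[of z y x] abc[of y x z]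
    by (cases "lab x"; cases "lab y"; cases "lab z"; simp; blast)
  ultimately show "\<exists>lab. labelling_nice G lab"
    using edge unfolding labelling_nice_def by blast
next
  let ?E = "parcs G"
  have sym: "(u, v) \<in> ?E \<longleftrightarrow> (v, u) \<in> ?E" for u v using arcs_symmetric by blast
  assume "\<exists>lab. labelling_nice G lab"
  then obtain lab where nice: "labelling_nice G lab" by blast
  have edge: "lab u \<noteq> lab v" if "(u, v) \<in> ?E" for u v
    using nice that unfolding labelling_nice_def by blast
  have four: "(x, y') \<in> ?E \<or> (x', y) \<in> ?E"
    if "x \<in> pverts G" "y \<in> pverts G" "x' \<in> pverts G" "y' \<in> pverts G"
      "lab x = lab x'" "lab y = lab y'" "lab x \<noteq> lab y" "(x, y) \<in> ?E" "(x', y') \<in> ?E" for x y x' y'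
    using nice that unfolding labelling_nice_def by blast
  have three: "\<not> ((x, y) \<in> ?E \<and> (y, z) \<in> ?E \<and> (z, x) \<in> ?E) \<and>
      \<not> ((x, y) \<notin> ?E \<and> (y, z) \<notin> ?E \<and> (z, x) \<notin> ?E)"
    if "x \<in> pverts G" "y \<in> pverts G" "z \<in> pverts G" "distinct [lab x, lab y, lab z]" for x y z
    using nice that unfolding labelling_nice_def by blast
  define P where "P l = {u \<in> pverts G. lab u = l}" for l
  have indep: "independent_set (with_proj G) (P l)" for l
    by (auto simp: independent_set_def P_def dest: edge)
  have bip: "bipartite (with_proj G \<restriction> (P k \<union> P l))" if "k \<noteq> l" for k l
    unfolding bipartite_def induce_subgraph_with_proj
    using that by (intro exI[of _ "P k"] exI[of _ "P l"])
      (auto simp: independent_set_def P_def dest: edge)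
  have free: "two_K2_free (with_proj G \<restriction> (P k \<union> P l))" if "k \<noteq> l" for k l
  proof -
    have False if S: "x \<in> P k \<union> P l" "y \<in> P k \<union> P l" "x' \<in> P k \<union> P l" "y' \<in> P k \<union> P l"
      and E: "(x, y) \<in> ?E" "(x', y') \<in> ?E" and nE: "(x, x') \<notin> ?E" "(x, y') \<notin> ?E"
        "(y, x') \<notin> ?E" "(y, y') \<notin> ?E" for x y x' y'
    \<comment> \<open>Each of the two edges joins the two classes. If they run in opposite
      directions, reversing the second one, that is, exchanging \<open>x'\<close> and
      \<open>y'\<close>, reduces to \<open>four\<close> again.\<close>
    proof (cases "lab x = lab x'")
      case True
      then have "lab y = lab y'" using S edge[OF E(1)] edge[OF E(2)] by (auto simp: P_def)
      then show False using four[of x y x' y'] True S E nE edge[OF E(1)] sym[of x' y]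
        by (auto simp: P_def)
    next
      case False
      then have "lab x = lab y'" "lab y = lab x'"
        using S edge[OF E(1)] edge[OF E(2)] by (auto simp: P_def)
      then show False using four[of x y y' x'] S E nE edge[OF E(1)] sym[of x' y'] sym[of y' y]
        by (auto simp: P_def)
    qed
    moreover have "P k \<union> P l \<subseteq> pverts G" by (auto simp: P_def)
    ultimately show ?thesis using two_K2_free_induce_iff by blast
  qed
  have triple: "\<not> (K\<^bsub>3\<^esub> (with_proj G \<restriction> {a, b, c}) \<or>
      independent_set (with_proj G) {a, b, c} \<and> card {a, b, c} = 3)"
    if "a \<in> P La" "b \<in> P Lb" "c \<in> P Lc" for a b c
  proof -
    have "{a, b, c} \<subseteq> pverts G" "distinct [a, b, c]" "distinct [lab a, lab b, lab c]"
      using that by (auto simp: P_def)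
    then show ?thesis using three[of a b c] complete_3_induce_iff[of a b c]
      by (auto simp: independent_set_def)
  qed
  have cover: "pverts G = P La \<union> P Lb \<union> P Lc"
  proof -
    have "lab u = La \<or> lab u = Lb \<or> lab u = Lc" for u by (cases "lab u") auto
    then show ?thesis by (auto simp: P_def)
  qed
  have disj: "P La \<inter> P Lb = {}" "P Lb \<inter> P Lc = {}" "P Lc \<inter> P La = {}"
    by (auto simp: P_def)
  show "nice (with_proj G)"
    unfolding nice_def
    by (rule exI[of _ "P La"], rule exI[of _ "P Lb"], rule exI[of _ "P Lc"])
      (use cover disj indep bip free triple in simp)
qed

section \<open>Acyclicity of the cyclic orientation\<close>

text \<open>The decoder is a directed triangle on the letters and so contains exactly one of any two
  opposite pairs of distinct letters. For symmetric \<open>G\<close> this makes the relation a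
  multipartite tournament with the label classes as parts.\<close>

definition cyclic_orientation :: "'a pair_pre_digraph \<Rightarrow> ('a \<Rightarrow> abc) \<Rightarrow> 'a rel" where
  "cyclic_orientation G lab = {(u, v). u \<in> pverts G \<and> v \<in> pverts G \<and> lab u \<noteq> lab v \<and>
    ((u, v) \<in> parcs G \<longleftrightarrow> (lab u, lab v) \<in> cyclic_decoder)}"

lemma cyclic_decoder_swap: "p \<noteq> q \<Longrightarrow> (q, p) \<in> cyclic_decoder \<longleftrightarrow> (p, q) \<notin> cyclic_decoder"
  by (cases p; cases q) (auto simp: cyclic_decoder_def)

text \<open>Strong induction on the length of a closed walk. In a shortest one, a forward chord
  would give a shorter closed walk, so every chord between different parts points backward; this
  closes a 3-cycle or a 4-cycle alternating between two parts.\<close>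

lemma multipartite_tournament_acyclic:
  fixes part :: "'a \<Rightarrow> 'p"
  assumes part: "\<And>u v. (u, v) \<in> R \<Longrightarrow> u \<in> V \<and> v \<in> V \<and> part u \<noteq> part v"
    and tour: "\<And>u v. u \<in> V \<Longrightarrow> v \<in> V \<Longrightarrow> part u \<noteq> part v \<Longrightarrow> (u, v) \<in> R \<longleftrightarrow> (v, u) \<notin> R"
    and no3: "\<And>x y z. (x, y) \<in> R \<Longrightarrow> (y, z) \<in> R \<Longrightarrow> (z, x) \<notin> R"
    and no4: "\<And>x y x' y'. (x, y) \<in> R \<Longrightarrow> (y, x') \<in> R \<Longrightarrow> (x', y') \<in> R \<Longrightarrow>
      part x = part x' \<Longrightarrow> part y = part y' \<Longrightarrow> (y', x) \<notin> R"
  shows "acyclic R"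
proof -
  have "(x, x) \<notin> R ^^ n" if "n > 0" for n x
    using that
  proof (induction n arbitrary: x rule: less_induct)
    case (less n)
    show ?case
    proof
      assume cyc: "(x, x) \<in> R ^^ n"
      have "n \<noteq> 1" using cyc part[of x x] by auto
      moreover have "n \<noteq> 2"
      proof
        assume "n = 2"
        then obtain y where "(x, y) \<in> R" "(y, x) \<in> R" using cyc by (auto simp: numeral_2_eq_2)
        then show False using part tour by blast
      qed
      ultimately obtain m where n: "n = Suc (Suc (Suc m))"
        using less.prems by (metis One_nat_def Suc_1 not0_implies_Suc not_less_zero)
      \<comment> \<open>Vertices of the walk may repeat; for \<open>m = 0\<close> the walk is a
        triangle with \<open>w = x\<close>, and the argument below still applies.\<close>
      obtain y z w where e: "(x, y) \<in> R" "(y, z) \<in> R" "(z, w) \<in> R" and rest: "(w, x) \<in> R ^^ m"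
        using cyc unfolding n by (blast dest: relpow_Suc_D2)
      \<comment> \<open>Each of these three chords would replace two or three consecutive arcs by
        one, against the induction hypothesis.\<close>
      have xz: "(x, z) \<notin> R"
        using less.IH[of "Suc (Suc m)" x] relpow_Suc_I2[OF _ relpow_Suc_I2[OF e(3) rest]] n by auto
      have yw: "(y, w) \<notin> R"
        using less.IH[of "Suc (Suc m)" x] relpow_Suc_I2[OF e(1) relpow_Suc_I2[OF _ rest]] n by auto
      have xw: "(x, w) \<notin> R"
        using less.IH[of "Suc m" x] relpow_Suc_I2[OF _ rest] n by auto
      \<comment> \<open>Were the parts different, the absent chord would be present in reverse and
        close a 3-cycle. Afterwards \<open>x\<close> and \<open>w\<close> lie in different parts
        because \<open>z\<close> and \<open>w\<close> do, so \<open>(w, x)\<close> closes the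
        alternating 4-cycle.\<close>
      have "part x = part z" using xz tour part e no3 by metis
      moreover have "part y = part w" using yw tour part e no3 by metis
      moreover have "(w, x) \<in> R" using xw tour part e calculation by metis
      ultimately show False using no4[OF e] by blast
    qed
  qed
  then show ?thesis unfolding acyclic_def trancl_power by blast
qed

lemma labelling_nice_acyclic:
  assumes "pair_graph G" and nice: "labelling_nice G lab"
  shows "acyclic (cyclic_orientation G lab)"
proof -
  interpret pair_graph G by fact
  have sym: "(u, v) \<in> parcs G \<longleftrightarrow> (v, u) \<in> parcs G" for u v using arcs_symmetric by blast
  show ?thesis
  proof (rule multipartite_tournament_acyclic[where V = "pverts G" and part = lab])
    show "u \<in> pverts G \<and> v \<in> pverts G \<and> lab u \<noteq> lab v" if "(u, v) \<in> cyclic_orientation G lab" for u v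
      using that by (auto simp: cyclic_orientation_def)
    show "(u, v) \<in> cyclic_orientation G lab \<longleftrightarrow> (v, u) \<notin> cyclic_orientation G lab"
      if "u \<in> pverts G" "v \<in> pverts G" "lab u \<noteq> lab v" for u v
      using that sym[of u v] cyclic_decoder_swap[OF that(3)] by (auto simp: cyclic_orientation_def)
    show "(z, x) \<notin> cyclic_orientation G lab"
      if "(x, y) \<in> cyclic_orientation G lab" "(y, z) \<in> cyclic_orientation G lab" for x y z
    proof
      assume "(z, x) \<in> cyclic_orientation G lab"
      with that have D: "x \<in> pverts G" "y \<in> pverts G" "z \<in> pverts G" "distinct [lab x, lab y, lab z]"
        and E: "(x, y) \<in> parcs G \<longleftrightarrow> (lab x, lab y) \<in> cyclic_decoder"
          "(y, z) \<in> parcs G \<longleftrightarrow> (lab y, lab z) \<in> cyclic_decoder"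
          "(z, x) \<in> parcs G \<longleftrightarrow> (lab z, lab x) \<in> cyclic_decoder"
        by (auto simp: cyclic_orientation_def)
      \<comment> \<open>Three distinct letters run around the decoder triangle entirely with or
        entirely against its direction, so the 3-cycle consists of three edges or of three
        non-edges.\<close>
      have "(lab x, lab y) \<in> cyclic_decoder \<longleftrightarrow> (lab y, lab z) \<in> cyclic_decoder"
        "(lab y, lab z) \<in> cyclic_decoder \<longleftrightarrow> (lab z, lab x) \<in> cyclic_decoder"
        using D(4) by (cases "lab x"; cases "lab y"; cases "lab z"; simp add: cyclic_decoder_def)+
      with D E nice show False unfolding labelling_nice_def by blast
    qed
    show "(y', x) \<notin> cyclic_orientation G lab"
      if "(x, y) \<in> cyclic_orientation G lab" "(y, x') \<in> cyclic_orientation G lab"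
        "(x', y') \<in> cyclic_orientation G lab" and lab: "lab x = lab x'" "lab y = lab y'" for x y x' y'
    proof
      assume "(y', x) \<in> cyclic_orientation G lab"
      with that have V: "x \<in> pverts G" "y \<in> pverts G" "x' \<in> pverts G" "y' \<in> pverts G"
        and ne: "lab x \<noteq> lab y"
        and E: "(x, y) \<in> parcs G \<longleftrightarrow> (lab x, lab y) \<in> cyclic_decoder"
          "(y, x') \<in> parcs G \<longleftrightarrow> (lab y, lab x) \<in> cyclic_decoder"
          "(x', y') \<in> parcs G \<longleftrightarrow> (lab x, lab y) \<in> cyclic_decoder"
          "(y', x) \<in> parcs G \<longleftrightarrow> (lab y, lab x) \<in> cyclic_decoder"
        by (auto simp: cyclic_orientation_def)
      \<comment> \<open>Membership in the decoder alternates along the 4-cycle, so edges and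
        non-edges alternate and form an induced 2K_2. Fact \<open>1\<close> excludes one choice of
        the edges; fact \<open>2\<close>, with \<open>y\<close> and \<open>y'\<close> exchanged,
        excludes the other.\<close>
      have 1: "(x, y) \<in> parcs G \<Longrightarrow> (x', y') \<in> parcs G \<Longrightarrow> (x, y') \<in> parcs G \<or> (x', y) \<in> parcs G"
        using nice V lab ne unfolding labelling_nice_def by blast
      have 2: "(x, y') \<in> parcs G \<Longrightarrow> (x', y) \<in> parcs G \<Longrightarrow> (x, y) \<in> parcs G \<or> (x', y') \<in> parcs G"
        using nice V lab ne unfolding labelling_nice_def by metis
      show False using 1 2 E cyclic_decoder_swap[OF ne] sym[of y x'] sym[of y' x] by blast
    qed
  qed
qed

section \<open>From an acyclic orientation to a word\<close>

text \<open>Repeatedly take a minimal element of what is left. The order is expressed negatively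
  because \<open>R\<close> need not be total: vertices with equal labels will be unrelated.\<close>

lemma acyclic_topological_ordering:
  assumes "finite V" and "acyclic R"
  shows "\<exists>xs. distinct xs \<and> set xs = V \<and> sorted_wrt (\<lambda>x y. (y, x) \<notin> R) xs"
  using \<open>finite V\<close>
proof (induction "card V" arbitrary: V)
  case 0
  then show ?case by simp
next
  case (Suc n)
  \<comment> \<open>\<open>R\<close> itself may be infinite; its restriction to \<open>V\<close> is
    finite, so acyclicity gives well-foundedness.\<close>
  have "wf (R \<inter> V \<times> V)"
    using Suc.prems \<open>acyclic R\<close> by (auto intro!: finite_acyclic_wf acyclic_subset[OF \<open>acyclic R\<close>])
  moreover obtain v where "v \<in> V" using Suc.hyps(2) by fastforce
  ultimately obtain m where "m \<in> V" "\<And>y. (y, m) \<in> R \<inter> V \<times> V \<Longrightarrow> y \<notin> V"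
    by (rule wfE_min) blast
  then have m: "m \<in> V" "\<And>y. y \<in> V \<Longrightarrow> (y, m) \<notin> R" by blast+
  have "n = card (V - {m})" using Suc.hyps(2) Suc.prems m(1) by simp
  then obtain xs where "distinct xs" "set xs = V - {m}" "sorted_wrt (\<lambda>x y. (y, x) \<notin> R) xs"
    using Suc.hyps(1) Suc.prems by blast
  with m show ?case by (intro exI[of _ "m # xs"]) auto
qed

text \<open>The word is the list of labels along a topological ordering.\<close>

lemma acyclic_orientation_imp_letter_graph:
  assumes "pair_graph G" and "\<And>u v. (u, v) \<in> parcs G \<Longrightarrow> lab u \<noteq> lab v"
    and "acyclic (cyclic_orientation G lab)"
  shows "\<exists>w. digraph_iso (with_proj G) (with_proj (letter_graph cyclic_decoder w))"
proof -
  interpret pair_graph G by fact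
  let ?D = "cyclic_orientation G lab"
  have sym: "(u, v) \<in> parcs G \<longleftrightarrow> (v, u) \<in> parcs G" for u v using arcs_symmetric by blast
  obtain xs where d: "distinct xs" and V: "set xs = pverts G"
    and srt: "sorted_wrt (\<lambda>x y. (y, x) \<notin> ?D) xs"
    using acyclic_topological_ordering[OF pair_finite_verts assms(3)] by blast
  let ?n = "length xs" and ?w = "map lab xs"
  interpret L: pair_graph "letter_graph cyclic_decoder ?w" by (rule pair_graph_letter_graph)
  have arc_less: "(xs ! i, xs ! j) \<in> parcs G \<longleftrightarrow> (lab (xs ! i), lab (xs ! j)) \<in> cyclic_decoder"
    if "i < j" "j < ?n" for i j
  proof -
    have nD: "(xs ! j, xs ! i) \<notin> ?D" using srt that by (auto simp: sorted_wrt_iff_nth_less)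
    have V': "xs ! i \<in> pverts G" "xs ! j \<in> pverts G" using that by (simp_all flip: V)
    show ?thesis
    \<comment> \<open>Equal labels make both sides false. For different labels the missing backward
      arc of \<open>?D\<close> forces a forward one, which is the claimed equivalence.\<close>
    proof (cases "lab (xs ! i) = lab (xs ! j)")
      case True
      then show ?thesis
        using assms(2)[of "xs ! i" "xs ! j"] by (cases "lab (xs ! j)") (auto simp: cyclic_decoder_def)
    next
      case False
      then show ?thesis
        using nD V' cyclic_decoder_swap[OF False] sym[of "xs ! i" "xs ! j"]
        by (auto simp: cyclic_orientation_def)
    qed
  qed
  \<comment> \<open>Positions in a letter graph start at 1 and list indices at 0, hence the
    shift.\<close>
  have bij: "bij_betw (\<lambda>i. xs ! (i - 1)) {1..?n} (pverts G)"
  proof -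
    have "bij_betw (\<lambda>i. i - 1) {1..?n} {..<?n}"
      by (rule bij_betw_byWitness[where f' = Suc]) auto
    from bij_betw_trans[OF this bij_betw_nth[OF d refl V[symmetric]]]
    show ?thesis by (simp add: o_def)
  qed
  have "(i, j) \<in> parcs (letter_graph cyclic_decoder ?w) \<longleftrightarrow> (xs ! (i - 1), xs ! (j - 1)) \<in> parcs G"
    if "i \<in> {1..?n}" "j \<in> {1..?n}" for i j
  proof (cases i j rule: linorder_cases)
    case less
    then show ?thesis using that arc_less[of "i - 1" "j - 1"] by (auto simp: letter_graph_def)
  next
    case equal
    then show ?thesis using no_loops' by (auto simp: letter_graph_def)
  next
    case greater
    then show ?thesis using that arc_less[of "j - 1" "i - 1"] sym[of "xs ! (i - 1)"]
      by (auto simp: letter_graph_def)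
  qed
  with bij have "digraph_iso (with_proj (letter_graph cyclic_decoder ?w)) (with_proj G)"
    unfolding digraph_iso_with_proj_iff[OF L.pair_wf_digraph_axioms pair_wf_digraph_axioms]
    by (intro exI[of _ "\<lambda>i. xs ! (i - 1)"]) (simp add: letter_graph_def)
  then show ?thesis using L.wf_digraph_axioms digraph_iso_swap by blast
qed

section \<open>Niceness of letter graphs\<close>

text \<open>Each vertex is labelled by the letter at its position. A violated clause on 2K_2 or on
  triples would make positions increase around a cycle.\<close>

lemma letter_graph_imp_labelling_nice:
  assumes "pair_graph G"
    and "digraph_iso (with_proj G) (with_proj (letter_graph cyclic_decoder w))"
  shows "\<exists>lab. labelling_nice G lab"
proof -
  interpret pair_graph G by fact
  interpret L: pair_graph "letter_graph cyclic_decoder w" by (rule pair_graph_letter_graph)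
  obtain f where bij: "bij_betw f (pverts G) {1..length w}"
    and arc: "\<forall>u\<in>pverts G. \<forall>v\<in>pverts G.
      (u, v) \<in> parcs G \<longleftrightarrow> (f u, f v) \<in> parcs (letter_graph cyclic_decoder w)"
    using assms(2) digraph_iso_with_proj_iff[OF pair_wf_digraph_axioms L.pair_wf_digraph_axioms]
    by (auto simp: letter_graph_def)
  define lab where "lab u = w ! (f u - 1)" for u
  have range: "f u \<in> {1..length w}" if "u \<in> pverts G" for u
    using that bij by (auto simp: bij_betw_def)
  have arc_iff: "(u, v) \<in> parcs G \<longleftrightarrow>
      f u < f v \<and> (lab u, lab v) \<in> cyclic_decoder \<or> f v < f u \<and> (lab v, lab u) \<in> cyclic_decoder"
    if "u \<in> pverts G" "v \<in> pverts G" for u v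
    using that arc range[OF that(1)] range[OF that(2)] by (auto simp: letter_graph_def lab_def)
  \<comment> \<open>\<open>lab\<close> factors through \<open>f\<close>.\<close>
  have ne: "f u \<noteq> f v" if "lab u \<noteq> lab v" for u v
    using that by (auto simp: lab_def)
  have adj: "(u, v) \<in> parcs G \<longleftrightarrow> (f u < f v \<longleftrightarrow> (lab u, lab v) \<in> cyclic_decoder)"
    if "u \<in> pverts G" "v \<in> pverts G" "lab u \<noteq> lab v" for u v
    using arc_iff[OF that(1,2)] ne[OF that(3)] cyclic_decoder_swap[OF that(3)] by auto
  have "labelling_nice G lab"
    unfolding labelling_nice_def
  proof (intro conjI allI ballI impI; (elim conjE)?)
    fix u v assume "(u, v) \<in> parcs G"
    moreover have "(p, p) \<notin> cyclic_decoder" for p by (cases p) (auto simp: cyclic_decoder_def)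
    ultimately show "lab u \<noteq> lab v" using arc_iff wellformed' by metis
  next
    fix x y x' y'
    assume V: "x \<in> pverts G" "y \<in> pverts G" "x' \<in> pverts G" "y' \<in> pverts G"
      and lab: "lab x = lab x'" "lab y = lab y'" "lab x \<noteq> lab y"
      and "(x, y) \<in> parcs G" "(x', y') \<in> parcs G"
    \<comment> \<open>Otherwise the positions of \<open>x\<close>, \<open>y\<close>,
      \<open>x'\<close>, \<open>y'\<close> and again \<open>x\<close> would form a strictly
      increasing chain if the label pair is in the decoder, and a strictly decreasing one if
      not.\<close>
    then show "(x, y') \<in> parcs G \<or> (x', y) \<in> parcs G"
      using adj[of x y] adj[of x' y'] adj[of x y'] adj[of x' y] ne[of x y] ne[of x' y'] ne[of x y'] ne[of x' y]
      by (cases "(lab x, lab y) \<in> cyclic_decoder") auto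
  next
    fix x y z
    assume V: "x \<in> pverts G" "y \<in> pverts G" "z \<in> pverts G" and d: "distinct [lab x, lab y, lab z]"
    have dec: "(lab x, lab y) \<in> cyclic_decoder \<longleftrightarrow> (lab y, lab z) \<in> cyclic_decoder"
      "(lab y, lab z) \<in> cyclic_decoder \<longleftrightarrow> (lab z, lab x) \<in> cyclic_decoder"
      using d by (cases "lab x"; cases "lab y"; cases "lab z"; simp add: cyclic_decoder_def)+
    have adj3: "(x, y) \<in> parcs G \<longleftrightarrow> (f x < f y \<longleftrightarrow> (lab x, lab y) \<in> cyclic_decoder)"
      "(y, z) \<in> parcs G \<longleftrightarrow> (f y < f z \<longleftrightarrow> (lab y, lab z) \<in> cyclic_decoder)"
      "(z, x) \<in> parcs G \<longleftrightarrow> (f z < f x \<longleftrightarrow> (lab z, lab x) \<in> cyclic_decoder)"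
      using adj V d by auto
    \<comment> \<open>The three decoder memberships agree, so three edges or three non-edges would
      order \<open>f x\<close>, \<open>f y\<close>, \<open>f z\<close> cyclically.\<close>
    have "f x \<noteq> f y" "f y \<noteq> f z" "f z \<noteq> f x" using ne d by auto
    with adj3 dec
    show "\<not> ((x, y) \<in> parcs G \<and> (y, z) \<in> parcs G \<and> (z, x) \<in> parcs G)"
      "\<not> ((x, y) \<notin> parcs G \<and> (y, z) \<notin> parcs G \<and> (z, x) \<notin> parcs G)"
      by linarith+
  qed
  then show ?thesis by blast
qed

theorem theorem5:
  fixes G :: "'a pair_pre_digraph"
  assumes "pair_graph G"
  shows "(\<exists>w :: abc list. digraph_iso (with_proj G) (with_proj (letter_graph cyclic_decoder w)))
    \<longleftrightarrow> nice (with_proj G)"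
proof -
  have "\<exists>w. digraph_iso (with_proj G) (with_proj (letter_graph cyclic_decoder w))"
    if nice: "labelling_nice G lab" for lab
  proof (rule acyclic_orientation_imp_letter_graph[OF assms _ labelling_nice_acyclic[OF assms nice]])
    show "lab u \<noteq> lab v" if "(u, v) \<in> parcs G" for u v
      using nice that unfolding labelling_nice_def by blast
  qed
  then show ?thesis
    using letter_graph_imp_labelling_nice[OF assms] pair_graph.nice_iff_labelling[OF assms] by blast
qed

end
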